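(* Let $K,r,S\in[1,\infty)$, $\theta_d\in[-S,S]^d$ for $d\in\mathbb N$, and suppose $f:\mathbb R\to\mathbb R$ is $K$-Lipschitz continuous with $|f(0)|\le K$. Consider the ridge functions $g_d:\mathbb R^d\to\mathbb R$ given by $g_d(x)=f(\theta_d\cdot x)$. Then for all $d\in\mathbb N$ and $\varepsilon\in(0,1]$, there exists $\phi\in\mathcal N$ with $\mathcal R_{\mathrm{ReLU}}^\phi\in C(\mathbb R^d,\mathbb R)$ such that 1) $\sup_{x\in[-r,r]^d}|g_d(x)-\mathcal R_{\mathrm{ReLU}}^\phi(x)|\le\varepsilon$, 2) $\mathcal R_{\mathrm{ReLU}}^\phi$ is $\sqrt d\,K S$-Lipschitz continuous on $\mathbb R^d$, and 3) $\mathcal P(\phi)\le\tfrac17\,10^3\,K^2\,r\,S^2\,d^6\,\varepsilon^{-1}$.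
   Context: $\mathbb N=\{1,2,\dots\}$; $\theta\cdot x$ is the standard inner product; Lipschitz continuity is with respect to the Euclidean norm. A skeleton is $\phi=[(V_1,b_1),\dots,(V_D,b_D)]$ with $D\in\mathbb N$, $l_0,\dots,l_D\in\mathbb N$, $V_k\in\mathbb R^{l_k\times l_{k-1}}$, $b_k\in\mathbb R^{l_k}$. $\mathcal N$ is the set of all skeletons, and the number of parameters is $\mathcal P(\phi)=\sum_{k=1}^D l_k(l_{k-1}+1)$. With $\mathrm{ReLU}(x)=\max\{x,0\}$ applied componentwise, the ReLU-realization is $\mathcal R_{\mathrm{ReLU}}^\phi=A_D\circ\mathrm{ReLU}\circ A_{D-1}\circ\cdots\circ\mathrm{ReLU}\circ A_1\in C(\mathbb R^{l_0},\mathbb R^{l_D})$ with $A_k(x)=V_kx+b_k$. *)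

theory Defs
  imports "HOL-Analysis.Analysis" "Jordan_Normal_Form.Matrix"
begin

(* The symbols for vector entries and scalar products denote the Jordan_Normal_Form operations. *)
unbundle no vec_syntax
unbundle no inner_syntax

hide_type (open) Finite_Cartesian_Product.vec
hide_const (open) Finite_Cartesian_Product.vec

text \<open>Euclidean space of dimension \<open>n\<close> is the carrier \<open>carrier_vec n\<close> of real vectors.\<close>

definition eucl_norm :: "real vec \<Rightarrow> real" where
  "eucl_norm x = sqrt (x \<bullet> x)"

definition cube :: "nat \<Rightarrow> real \<Rightarrow> real vec set" where
  "cube n a = {x \<in> carrier_vec n. \<forall>i<n. x $ i \<in> {-a..a}}"

definition continuous_maps :: "nat \<Rightarrow> nat \<Rightarrow> (real vec \<Rightarrow> real vec) set" where
  "continuous_maps m n =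
    {F. F \<in> carrier_vec m \<rightarrow> carrier_vec n \<and>
        (\<forall>x\<in>carrier_vec m. \<forall>e>0. \<exists>\<delta>>0. \<forall>y\<in>carrier_vec m.
           eucl_norm (y - x) < \<delta> \<longrightarrow> eucl_norm (F y - F x) < e)}"

definition lipschitz_map :: "real \<Rightarrow> nat \<Rightarrow> (real vec \<Rightarrow> real vec) \<Rightarrow> bool" where
  "lipschitz_map L m F \<longleftrightarrow>
    0 \<le> L \<and> (\<forall>x\<in>carrier_vec m. \<forall>y\<in>carrier_vec m.
      eucl_norm (F x - F y) \<le> L * eucl_norm (x - y))"

type_synonym skeleton = "(real mat \<times> real vec) list"

text \<open>The sizes \<open>l\<^sub>0, \<dots>, l\<^sub>D\<close>: \<open>l\<^sub>0\<close> is the number of columns of the first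
  matrix and \<open>l\<^sub>k\<close> is the number of rows of the \<open>k\<close>-th matrix, which sits at list
  index \<open>k - 1\<close>.\<close>

fun layer_size :: "skeleton \<Rightarrow> nat \<Rightarrow> nat" where
  "layer_size \<phi> 0 = dim_col (fst (\<phi> ! 0))"
| "layer_size \<phi> (Suc k) = dim_row (fst (\<phi> ! k))"

definition skeletons :: "skeleton set" where
  "skeletons =
    {\<phi>. length \<phi> \<ge> 1 \<and> (\<forall>k\<le>length \<phi>. layer_size \<phi> k \<ge> 1) \<and>
        (\<forall>k<length \<phi>.
           fst (\<phi> ! k) \<in> carrier_mat (layer_size \<phi> (Suc k)) (layer_size \<phi> k) \<and>
           snd (\<phi> ! k) \<in> carrier_vec (layer_size \<phi> (Suc k)))}"

definition num_params :: "skeleton \<Rightarrow> nat" where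
  "num_params \<phi> =
    (\<Sum>k=1..length \<phi>. layer_size \<phi> k * (layer_size \<phi> (k - 1) + 1))"

definition relu :: "real \<Rightarrow> real" where
  "relu t = max t 0"

definition layer_map :: "real mat \<times> real vec \<Rightarrow> real vec \<Rightarrow> real vec" where
  "layer_map A x = fst A *\<^sub>v x + snd A"

text \<open>No activation is applied after the last affine map. The value on the empty list, which is
  not a skeleton, is immaterial.\<close>

fun realization :: "(real \<Rightarrow> real) \<Rightarrow> skeleton \<Rightarrow> real vec \<Rightarrow> real vec" where
  "realization \<rho> [] x = x"
| "realization \<rho> [A] x = layer_map A x"
| "realization \<rho> (A # B # \<phi>) x = realization \<rho> (B # \<phi>) (map_vec \<rho> (layer_map A x))"

end

theory Submission
  imports Defs
begin

text \<open>On the cube, \<open>\<theta> d \<bullet> x\<close> stays in \<open>[-dSr, dSr]\<close>, so it suffices to approximate the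
  one-variable function \<open>f\<close> there. The piecewise linear interpolant of \<open>f\<close> on a uniform grid,
  continued by constants, is \<open>K\<close>-Lipschitz and agrees with \<open>f\<close> at the nodes, hence is within
  \<open>2K\<close> times the mesh size of \<open>f\<close>. It is a combination of two ReLU functions per grid
  interval, so its composition with the linear form is a network with one hidden layer.\<close>

section \<open>Piecewise linear interpolation\<close>

definition grid :: "real \<Rightarrow> real \<Rightarrow> nat \<Rightarrow> real" where
  "grid a h i = a + real i * h"

definition slope :: "(real \<Rightarrow> real) \<Rightarrow> real \<Rightarrow> real \<Rightarrow> nat \<Rightarrow> real" where
  "slope f a h i = (f (grid a h (Suc i)) - f (grid a h i)) / h"

text \<open>For positive \<open>h\<close> this is 0 to the left of the \<open>i\<close>-th cell, has
  slope 1 on it and stays at \<open>h\<close> to its right.\<close>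

definition ramp :: "real \<Rightarrow> real \<Rightarrow> nat \<Rightarrow> real \<Rightarrow> real" where
  "ramp a h i t = relu (t - grid a h i) - relu (t - grid a h (Suc i))"

text \<open>Each ramp adds the slope of its own cell and only a constant beyond it. This avoids a
  case distinction over the cells, builds in the constant continuation on both sides, and is already
  a combination of ReLU functions.\<close>

definition interpolant :: "(real \<Rightarrow> real) \<Rightarrow> real \<Rightarrow> real \<Rightarrow> nat \<Rightarrow> real \<Rightarrow> real" where
  "interpolant f a h n t = f a + (\<Sum>i<n. slope f a h i * ramp a h i t)"

lemma grid_Suc: "grid a h (Suc i) = grid a h i + h"
  by (simp add: grid_def algebra_simps)

lemma grid_mono: "0 \<le> h \<Longrightarrow> i \<le> j \<Longrightarrow> grid a h i \<le> grid a h j"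
  by (simp add: grid_def mult_right_mono)

lemma ramp_mono: "0 \<le> h \<Longrightarrow> u \<le> v \<Longrightarrow> ramp a h i u \<le> ramp a h i v"
  by (auto simp: ramp_def relu_def grid_Suc max_def)

text \<open>Adjacent ramps share a node, so the sum telescopes into one long ramp over the whole
  grid.\<close>

lemma sum_ramp: "(\<Sum>i<n. ramp a h i t) = relu (t - a) - relu (t - grid a h n)"
  by (induction n) (simp_all add: ramp_def grid_def)

lemma abs_slope_le:
  assumes "K-lipschitz_on UNIV f" and "0 < h"
  shows "\<bar>slope f a h i\<bar> \<le> K"
proof -
  have "\<bar>f (grid a h (Suc i)) - f (grid a h i)\<bar> \<le> K * h"
    using lipschitz_onD[OF assms(1), of "grid a h (Suc i)" "grid a h i"] assms(2)
    by (simp add: dist_real_def grid_Suc)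
  then show ?thesis
    using assms(2) by (simp add: slope_def divide_le_eq)
qed

text \<open>Every slope is at most \<open>K\<close> in absolute value, so increments are controlled
  by those of the sum of all ramps, which is 1-Lipschitz. Estimating the ramps one by one would lose
  a factor \<open>n\<close>.\<close>

lemma interpolant_lipschitz:
  assumes f: "K-lipschitz_on UNIV f" and h: "0 < h"
  shows "K-lipschitz_on UNIV (interpolant f a h n)"
proof (rule lipschitz_onI)
  show K: "0 \<le> K"
    using f by (rule lipschitz_on_nonneg)
  \<comment> \<open>For ordered arguments the ramp increments are nonnegative, so their absolute
    values disappear and the sum can telescope.\<close>
  have le: "\<bar>interpolant f a h n v - interpolant f a h n u\<bar> \<le> K * (v - u)" if uv: "u \<le> v" for u v
  proof -
    have "\<bar>interpolant f a h n v - interpolant f a h n u\<bar>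
        = \<bar>\<Sum>i<n. slope f a h i * (ramp a h i v - ramp a h i u)\<bar>"
      by (simp add: interpolant_def sum_subtractf right_diff_distrib)
    also have "\<dots> \<le> (\<Sum>i<n. \<bar>slope f a h i * (ramp a h i v - ramp a h i u)\<bar>)"
      by (rule sum_abs)
    also have "\<dots> \<le> (\<Sum>i<n. K * (ramp a h i v - ramp a h i u))"
    proof (rule sum_mono)
      fix i
      show "\<bar>slope f a h i * (ramp a h i v - ramp a h i u)\<bar> \<le> K * (ramp a h i v - ramp a h i u)"
        using abs_slope_le[OF f h, of a i] ramp_mono[OF less_imp_le[OF h] uv, of a i]
        by (simp add: abs_mult mult_right_mono)
    qed
    also have "\<dots> = K * ((\<Sum>i<n. ramp a h i v) - (\<Sum>i<n. ramp a h i u))"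
      by (simp add: sum_distrib_left sum_subtractf right_diff_distrib)
    also have "\<dots> \<le> K * (v - u)"
    proof (rule mult_left_mono[OF _ K])
      \<comment> \<open>The order of the end points makes the telescoped difference a ramp with
        slopes 0 and 1 only.\<close>
      have "a \<le> grid a h n"
        using h by (simp add: grid_def)
      then show "(\<Sum>i<n. ramp a h i v) - (\<Sum>i<n. ramp a h i u) \<le> v - u"
        using uv by (auto simp: sum_ramp relu_def max_def)
    qed
    finally show ?thesis .
  qed
  show "dist (interpolant f a h n u) (interpolant f a h n v) \<le> K * dist u v" for u v
    using le[of u v] le[of v u] by (cases "u \<le> v") (auto simp: dist_real_def abs_minus_commute)
qed

text \<open>Past its cell, a ramp has value \<open>h\<close> and contributes exactly the increment
  of \<open>f\<close> over that cell.\<close>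

lemma interpolant_right:
  assumes "0 < h" and "grid a h n \<le> t"
  shows "interpolant f a h n t = f (grid a h n)"
  using assms(2)
proof (induction n)
  case 0
  then show ?case
    by (simp add: interpolant_def grid_def)
next
  case (Suc n)
  have "ramp a h n t = h"
    using Suc.prems assms(1) by (simp add: ramp_def relu_def grid_Suc)
  then show ?case
    using Suc assms(1) by (simp add: interpolant_def slope_def grid_Suc)
qed

text \<open>The induction starts at \<open>n = i\<close>, where the node is the last one; every
  later cell has a ramp that vanishes at this node.\<close>

lemma interpolant_grid:
  assumes "0 < h" and "i \<le> n"
  shows "interpolant f a h n (grid a h i) = f (grid a h i)"
  using assms(2)
proof (induction n rule: dec_induct)
  case base
  show ?case
    using assms(1) by (simp add: interpolant_right)
next
  case (step n)
  have "ramp a h n (grid a h i) = 0"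
    using grid_mono[of h i n a] step.hyps assms(1) by (simp add: ramp_def relu_def grid_Suc)
  then show ?case
    using step.IH by (simp add: interpolant_def)
qed

text \<open>Both functions are compared with their common value at the nearest node to the left of
  \<open>t\<close>; each moves by at most \<open>K * h\<close> from there.\<close>

lemma interpolant_error:
  assumes f: "K-lipschitz_on UNIV f" and h: "0 < h" and t: "a \<le> t" "t \<le> grid a h n"
  shows "\<bar>f t - interpolant f a h n t\<bar> \<le> 2 * K * h"
proof -
  define i where "i = nat \<lfloor>(t - a) / h\<rfloor>"
  have i: "real i \<le> (t - a) / h" "(t - a) / h < real i + 1"
    using t(1) h by (auto simp: i_def)
  have ti: "grid a h i \<le> t" "t \<le> grid a h i + h"
    using i h by (simp_all add: grid_def field_simps)
  have "(t - a) / h \<le> real n"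
    using t h by (simp add: grid_def field_simps)
  \<comment> \<open>The value \<open>i = n\<close> occurs when \<open>t\<close> is the right end of
    the grid, which is still a node.\<close>
  then have "i \<le> n"
    using i by linarith
  then have eq: "interpolant f a h n (grid a h i) = f (grid a h i)"
    using h by (intro interpolant_grid)
  have "K * (t - grid a h i) \<le> K * h"
    using ti lipschitz_on_nonneg[OF f] by (intro mult_left_mono) auto
  then show ?thesis
    using lipschitz_onD[OF f, of t "grid a h i"] eq ti
      lipschitz_onD[OF interpolant_lipschitz[OF f h, of a n], of t "grid a h i"]
    by (auto simp: dist_real_def)
qed

text \<open>Neurons \<open>2i\<close> and \<open>2i + 1\<close> carry the two halves of the \<open>i\<close>-th ramp.\<close>

lemma interpolant_eq_sum_relu:
  "interpolant f a h n t = f a + (\<Sum>j<2 * n. (if even j then 1 else - 1) * slope f a h (j div 2)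
     * relu (t - grid a h (Suc j div 2)))"
  by (induction n) (simp_all add: interpolant_def ramp_def algebra_simps)

lemma lipschitz_relu_approximation:
  assumes f: "K-lipschitz_on UNIV f" and R: "0 < R" and n: "1 \<le> n"
  obtains p :: "real \<Rightarrow> real" and c b :: "nat \<Rightarrow> real"
  where "\<And>t. p t = f (- R) + (\<Sum>j<2 * n. c j * relu (t - b j))"
    and "K-lipschitz_on UNIV p"
    and "\<And>t. \<bar>t\<bar> \<le> R \<Longrightarrow> \<bar>f t - p t\<bar> \<le> 4 * K * R / real n"
proof -
  \<comment> \<open>With \<open>n\<close> cells on an interval of length \<open>2 * R\<close>, the
    error \<open>2 * K * h\<close> becomes \<open>4 * K * R / n\<close>.\<close>
  define h where "h = 2 * R / real n"
  have h: "0 < h"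
    using R n by (simp add: h_def)
  have last: "grid (- R) h n = R"
    using n by (simp add: grid_def h_def)
  show thesis
  proof (rule that)
    show "interpolant f (- R) h n t = f (- R) + (\<Sum>j<2 * n. (if even j then 1 else - 1)
        * slope f (- R) h (j div 2) * relu (t - grid (- R) h (Suc j div 2)))" for t
      by (rule interpolant_eq_sum_relu)
    show "K-lipschitz_on UNIV (interpolant f (- R) h n)"
      using f h by (rule interpolant_lipschitz)
    show "\<bar>f t - interpolant f (- R) h n t\<bar> \<le> 4 * K * R / real n" if "\<bar>t\<bar> \<le> R" for t
      using interpolant_error[OF f h, of "- R" t n] that last by (simp add: h_def abs_le_iff mult.assoc)
  qed
qed

section \<open>Euclidean geometry of the carrier\<close>

lemma eucl_norm_eq: "x \<in> carrier_vec n \<Longrightarrow> eucl_norm x = sqrt (\<Sum>i<n. (x $ i)\<^sup>2)"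
  by (auto simp: eucl_norm_def scalar_prod_def power2_eq_square atLeast0LessThan)

lemma eucl_norm_nonneg: "x \<in> carrier_vec n \<Longrightarrow> 0 \<le> eucl_norm x"
  by (simp add: eucl_norm_eq sum_nonneg)

lemma eucl_norm_vec_1: "eucl_norm (vec 1 v) = \<bar>v 0\<bar>"
  by (simp add: eucl_norm_eq[of _ 1])

lemma abs_scalar_prod_le:
  assumes "x \<in> carrier_vec n" and "y \<in> carrier_vec n"
  shows "\<bar>x \<bullet> y\<bar> \<le> eucl_norm x * eucl_norm y"
proof -
  have "(x \<bullet> y)\<^sup>2 \<le> (\<Sum>i<n. (x $ i)\<^sup>2) * (\<Sum>i<n. (y $ i)\<^sup>2)"
    using Cauchy_Schwarz_ineq_sum[of "\<lambda>i. x $ i" "\<lambda>i. y $ i" "{..<n}"] assms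
    by (simp add: scalar_prod_def atLeast0LessThan)
  then have "sqrt ((x \<bullet> y)\<^sup>2) \<le> sqrt ((\<Sum>i<n. (x $ i)\<^sup>2) * (\<Sum>i<n. (y $ i)\<^sup>2))"
    by (rule real_sqrt_le_mono)
  then show ?thesis
    using assms by (simp add: eucl_norm_eq real_sqrt_mult)
qed

lemma eucl_norm_cube_le:
  assumes "x \<in> cube n a" and "0 \<le> a"
  shows "eucl_norm x \<le> sqrt (real n) * a"
proof -
  have "(\<Sum>i<n. (x $ i)\<^sup>2) \<le> (\<Sum>i<n. a\<^sup>2)"
    using assms by (intro sum_mono) (auto simp: cube_def abs_le_square_iff[symmetric])
  then have "sqrt (\<Sum>i<n. (x $ i)\<^sup>2) \<le> sqrt (real n * a\<^sup>2)"
    by (intro real_sqrt_le_mono) simp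
  then show ?thesis
    using assms by (simp add: cube_def eucl_norm_eq[of x n] real_sqrt_mult)
qed

text \<open>By Cauchy-Schwarz, each of the two norms contributes a factor
  \<open>sqrt n\<close>.\<close>

lemma abs_scalar_prod_cube_le:
  assumes "x \<in> cube n a" and "y \<in> cube n b" and "0 \<le> a" and "0 \<le> b"
  shows "\<bar>x \<bullet> y\<bar> \<le> real n * a * b"
proof -
  have xy: "x \<in> carrier_vec n" "y \<in> carrier_vec n"
    using assms by (auto simp: cube_def)
  have "\<bar>x \<bullet> y\<bar> \<le> (sqrt (real n) * a) * (sqrt (real n) * b)"
    using assms by (intro order_trans[OF abs_scalar_prod_le[OF xy]] mult_mono eucl_norm_cube_le
        eucl_norm_nonneg[OF xy(2)]) auto
  also have "\<dots> = (sqrt (real n))\<^sup>2 * a * b"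
    by (simp only: power2_eq_square ac_simps)
  finally show ?thesis
    by simp
qed

lemma lipschitz_map_continuous:
  assumes L: "lipschitz_map L m F" and F: "F \<in> carrier_vec m \<rightarrow> carrier_vec n"
  shows "F \<in> continuous_maps m n"
  unfolding continuous_maps_def
proof (intro CollectI conjI F ballI allI impI)
  fix x :: "real vec" and e :: real
  assume x: "x \<in> carrier_vec m" and e: "0 < e"
  have L0: "0 \<le> L"
    using L by (simp add: lipschitz_map_def)
  show "\<exists>\<delta>>0. \<forall>y\<in>carrier_vec m. eucl_norm (y - x) < \<delta> \<longrightarrow> eucl_norm (F y - F x) < e"
  \<comment> \<open>Dividing by \<open>L + 1\<close> covers \<open>L = 0\<close> and makes the final
    inequality strict.\<close>
  proof (intro exI[of _ "e / (L + 1)"] conjI ballI impI)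
    show "0 < e / (L + 1)"
      using L0 e by simp
    fix y
    assume y: "y \<in> carrier_vec m" and lt: "eucl_norm (y - x) < e / (L + 1)"
    have "eucl_norm (F y - F x) \<le> L * eucl_norm (y - x)"
      using L x y by (simp add: lipschitz_map_def)
    also have "\<dots> \<le> L * (e / (L + 1))"
      using L0 lt by (intro mult_left_mono) auto
    also have "\<dots> < e"
      using L0 e by (simp add: field_simps)
    finally show "eucl_norm (F y - F x) < e" .
  qed
qed

text \<open>Cauchy-Schwarz makes the linear form Lipschitz with constant \<open>eucl_norm w\<close>.
  The formula for \<open>F\<close> is assumed on the carrier only, since that is where the
  realization of the network is computed.\<close>

lemma lipschitz_map_ridge:
  assumes p: "K-lipschitz_on UNIV p" and w: "w \<in> carrier_vec d" and L: "K * eucl_norm w \<le> L"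
    and F: "\<And>x. x \<in> carrier_vec d \<Longrightarrow> F x = vec 1 (\<lambda>_. p (w \<bullet> x))"
  shows "lipschitz_map L d F"
  unfolding lipschitz_map_def
proof (intro conjI ballI)
  have K: "0 \<le> K"
    using p by (rule lipschitz_on_nonneg)
  show "0 \<le> L"
    using L K eucl_norm_nonneg[OF w] by (meson mult_nonneg_nonneg order_trans)
  fix x y :: "real vec"
  assume x: "x \<in> carrier_vec d" and y: "y \<in> carrier_vec d"
  have xy: "x - y \<in> carrier_vec d"
    using x y by simp
  have "F x - F y = vec 1 (\<lambda>_. p (w \<bullet> x) - p (w \<bullet> y))"
    using x y by (auto simp: F)
  then have "eucl_norm (F x - F y) = \<bar>p (w \<bullet> x) - p (w \<bullet> y)\<bar>"
    by (simp only: eucl_norm_vec_1)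
  also have "\<dots> \<le> K * \<bar>w \<bullet> x - w \<bullet> y\<bar>"
    using lipschitz_onD[OF p, of "w \<bullet> x" "w \<bullet> y"] by (simp add: dist_real_def)
  also have "w \<bullet> x - w \<bullet> y = w \<bullet> (x - y)"
    using w x y by (simp add: scalar_prod_minus_distrib)
  also have "K * \<bar>w \<bullet> (x - y)\<bar> \<le> K * (eucl_norm w * eucl_norm (x - y))"
    using abs_scalar_prod_le[OF w xy] K by (rule mult_left_mono)
  also have "\<dots> = K * eucl_norm w * eucl_norm (x - y)"
    by simp
  also have "\<dots> \<le> L * eucl_norm (x - y)"
    using L eucl_norm_nonneg[OF xy] by (rule mult_right_mono)
  finally show "eucl_norm (F x - F y) \<le> L * eucl_norm (x - y)" .
qed

section \<open>Networks with one hidden layer\<close>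

text \<open>All rows of the first matrix equal \<open>w\<close>, so each hidden neuron sees the
  input through the single number \<open>w \<bullet> x\<close>, shifted by its own
  \<open>b i\<close>.\<close>

definition ridge_skeleton ::
    "nat \<Rightarrow> nat \<Rightarrow> real vec \<Rightarrow> (nat \<Rightarrow> real) \<Rightarrow> (nat \<Rightarrow> real) \<Rightarrow> real \<Rightarrow> skeleton" where
  "ridge_skeleton d m w b c c\<^sub>0 =
    [(mat m d (\<lambda>(i, j). w $ j), vec m (\<lambda>i. - b i)), (mat 1 m (\<lambda>(i, j). c j), vec 1 (\<lambda>_. c\<^sub>0))]"

lemma length_ridge_skeleton: "length (ridge_skeleton d m w b c c\<^sub>0) = 2"
  by (simp add: ridge_skeleton_def)

lemma layer_size_ridge_skeleton:
  "layer_size (ridge_skeleton d m w b c c\<^sub>0) 0 = d"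
  "layer_size (ridge_skeleton d m w b c c\<^sub>0) 1 = m"
  "layer_size (ridge_skeleton d m w b c c\<^sub>0) 2 = 1"
  by (simp_all add: ridge_skeleton_def numeral_2_eq_2)

lemma ridge_skeleton_in_skeletons:
  "1 \<le> d \<Longrightarrow> 1 \<le> m \<Longrightarrow> ridge_skeleton d m w b c c\<^sub>0 \<in> skeletons"
  by (auto simp: skeletons_def ridge_skeleton_def less_Suc_eq le_Suc_eq)

text \<open>The hidden layer contributes \<open>m * (d + 1)\<close> and the output layer
  \<open>m + 1\<close>.\<close>

lemma num_params_ridge_skeleton:
  "num_params (ridge_skeleton d m w b c c\<^sub>0) = m * (d + 2) + 1"
proof -
  have "{1..2} = {1, 2::nat}"
    by auto
  then show ?thesis
    using layer_size_ridge_skeleton[of d m w b c c\<^sub>0]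
    by (simp add: num_params_def length_ridge_skeleton algebra_simps)
qed

lemma realization_ridge_skeleton:
  assumes "w \<in> carrier_vec d" and "x \<in> carrier_vec d"
  shows "realization \<rho> (ridge_skeleton d m w b c c\<^sub>0) x
    = vec 1 (\<lambda>_. c\<^sub>0 + (\<Sum>j<m. c j * \<rho> (w \<bullet> x - b j)))"
proof -
  have "row (mat m d (\<lambda>(i, j). w $ j)) k = w" if "k < m" for k
    using that assms by (intro eq_vecI) auto
  then have "map_vec \<rho> (layer_map (mat m d (\<lambda>(i, j). w $ j), vec m (\<lambda>i. - b i)) x)
      = vec m (\<lambda>j. \<rho> (w \<bullet> x - b j))"
    using assms by (intro eq_vecI) (auto simp: layer_map_def)
  then show ?thesis
    by (auto simp: ridge_skeleton_def layer_map_def scalar_prod_def atLeast0LessThan intro!: eq_vecI)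
qed

section \<open>Ridge functions\<close>

text \<open>The left side counts the parameters when there are \<open>4 * X + 1\<close> grid cells.
  It is at most \<open>31 * X * d\<close>, and 31 lies below 1000/7.\<close>

lemma params_bound:
  fixes K r S \<epsilon> :: real and d :: nat
  assumes "1 \<le> K" "1 \<le> r" "1 \<le> S" "1 \<le> d" "0 < \<epsilon>" "\<epsilon> \<le> 1"
  defines "X \<equiv> K * (real d * S * r) / \<epsilon>"
  shows "2 * (4 * X + 1) * (real d + 2) + 1
    \<le> 1 / 7 * 10 ^ 3 * K\<^sup>2 * r * S\<^sup>2 * real d ^ 6 * inverse \<epsilon>"
proof -
  have d: "1 \<le> real d"
    using assms by simp
  have "1 * (1 * 1 * 1) \<le> K * (real d * S * r)"
    using assms d by (intro mult_mono) auto
  then have X1: "1 \<le> X"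
    using assms by (simp add: X_def le_divide_eq)
  have Xd: "1 * 1 \<le> X * real d"
    using X1 d by (intro mult_mono) auto
  \<comment> \<open>As \<open>X\<close> and \<open>d\<close> are at least 1,
    \<open>8 * X + 2\<close> is at most \<open>10 * X\<close> and \<open>d + 2\<close> at most
    \<open>3 * d\<close>.\<close>
  have "2 * (4 * X + 1) * (real d + 2) \<le> (10 * X) * (3 * real d)"
    using X1 d by (intro mult_mono[of "2 * (4 * X + 1)"]) auto
  then have "2 * (4 * X + 1) * (real d + 2) + 1 \<le> 31 * (X * real d)"
    using Xd by simp
  also have "\<dots> \<le> 1 / 7 * 10 ^ 3 * (X * real d)"
    using Xd by (intro mult_right_mono) auto
  \<comment> \<open>The exponents 1 are written out so that the powers of \<open>K\<close>,
    \<open>S\<close> and \<open>d\<close> can be raised factor by factor.\<close>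
  also have "X * real d = (K ^ 1 * r * S ^ 1 * real d ^ 2) * inverse \<epsilon>"
    by (simp add: X_def field_simps power2_eq_square)
  also have "1 / 7 * 10 ^ 3 * (K ^ 1 * r * S ^ 1 * real d ^ 2 * inverse \<epsilon>)
      \<le> 1 / 7 * 10 ^ 3 * (K ^ 2 * r * S ^ 2 * real d ^ 6 * inverse \<epsilon>)"
    using assms d
    by (intro mult_left_mono mult_right_mono mult_mono power_increasing) auto
  finally show ?thesis
    by (simp add: mult.assoc)
qed

theorem proposition34:
  fixes K r S :: real
    and \<theta> :: "nat \<Rightarrow> real vec"
    and f :: "real \<Rightarrow> real"
    and g :: "nat \<Rightarrow> real vec \<Rightarrow> real"
  assumes "K \<ge> 1" and "r \<ge> 1" and "S \<ge> 1"
    and "\<And>d. d \<ge> 1 \<Longrightarrow> \<theta> d \<in> cube d S"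
    and "K-lipschitz_on UNIV f"
    and "\<bar>f 0\<bar> \<le> K"
    and "\<And>d x. d \<ge> 1 \<Longrightarrow> x \<in> carrier_vec d \<Longrightarrow> g d x = f (\<theta> d \<bullet> x)"
  shows "\<forall>d::nat. \<forall>\<epsilon>::real. d \<ge> 1 \<and> 0 < \<epsilon> \<and> \<epsilon> \<le> 1 \<longrightarrow>
    (\<exists>\<phi>\<in>skeletons.
       layer_size \<phi> 0 = d \<and> layer_size \<phi> (length \<phi>) = 1 \<and>
       realization relu \<phi> \<in> continuous_maps d 1 \<and>
       (SUP x\<in>cube d r. ereal \<bar>g d x - realization relu \<phi> x $ 0\<bar>) \<le> ereal \<epsilon> \<and>
       lipschitz_map (sqrt (real d) * K * S) d (realization relu \<phi>) \<and>
       real (num_params \<phi>) \<le> 1 / 7 * 10 ^ 3 * K\<^sup>2 * r * S\<^sup>2 * real d ^ 6 * inverse \<epsilon>)"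
proof (intro allI impI, elim conjE)
  fix d :: nat and \<epsilon> :: real
  assume d: "1 \<le> d" and \<epsilon>: "0 < \<epsilon>" "\<epsilon> \<le> 1"
  \<comment> \<open>\<open>R\<close> bounds the linear form on the cube. The number \<open>n\<close>
    of cells is the least with \<open>4 * K * R / n\<close> at most \<open>\<epsilon>\<close>;
    rounding up costs at most one cell, hence the \<open>+ 1\<close> in
    \<open>params_bound\<close>.\<close>
  define R where "R = real d * S * r"
  define n where "n = nat \<lceil>4 * (K * R / \<epsilon>)\<rceil>"
  have R: "0 < R"
    using assms d by (simp add: R_def)
  have X: "0 < K * R / \<epsilon>"
    using assms R \<epsilon> by simp
  have n: "4 * (K * R / \<epsilon>) \<le> real n" "real n \<le> 4 * (K * R / \<epsilon>) + 1"
    using X unfolding n_def by linarith+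
  then have n1: "1 \<le> n"
    using X by linarith
  have \<theta>: "\<theta> d \<in> cube d S" "\<theta> d \<in> carrier_vec d"
    using assms(4)[OF d] by (auto simp: cube_def)
  obtain p c b
    where p: "\<And>t. p t = f (- R) + (\<Sum>j<2 * n. c j * relu (t - b j))"
      and lip: "K-lipschitz_on UNIV p"
      and err: "\<And>t. \<bar>t\<bar> \<le> R \<Longrightarrow> \<bar>f t - p t\<bar> \<le> 4 * K * R / real n"
    by (rule lipschitz_relu_approximation[OF assms(5) R n1]) (rule that)
  \<comment> \<open>There are two neurons per cell, and the output bias is the value of the
    interpolant at the left end of the grid.\<close>
  define \<phi> where "\<phi> = ridge_skeleton d (2 * n) (\<theta> d) b c (f (- R))"
  have real: "realization relu \<phi> x = vec 1 (\<lambda>_. p (\<theta> d \<bullet> x))" if "x \<in> carrier_vec d" for x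
    using that \<theta> by (simp add: \<phi>_def realization_ridge_skeleton p)
  \<comment> \<open>The factor \<open>sqrt d\<close> is the price of bounding the Euclidean norm of
    \<open>\<theta> d\<close> by its entries.\<close>
  have "K * eucl_norm (\<theta> d) \<le> sqrt (real d) * K * S"
    using mult_left_mono[OF eucl_norm_cube_le[OF \<theta>(1)], of K] assms by (simp add: ac_simps)
  then have lipm: "lipschitz_map (sqrt (real d) * K * S) d (realization relu \<phi>)"
    using lip \<theta>(2) real by (intro lipschitz_map_ridge)
  have cont: "realization relu \<phi> \<in> continuous_maps d 1"
    using lipm by (rule lipschitz_map_continuous) (auto simp: real)
  have sup: "(SUP x\<in>cube d r. ereal \<bar>g d x - realization relu \<phi> x $ 0\<bar>) \<le> ereal \<epsilon>"
  proof (rule SUP_least)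
    fix x
    assume x: "x \<in> cube d r"
    then have xc: "x \<in> carrier_vec d"
      by (simp add: cube_def)
    have "\<bar>\<theta> d \<bullet> x\<bar> \<le> R"
      using abs_scalar_prod_cube_le[OF \<theta>(1) x] assms by (simp add: R_def)
    then have "\<bar>f (\<theta> d \<bullet> x) - p (\<theta> d \<bullet> x)\<bar> \<le> 4 * K * R / real n"
      by (rule err)
    also have "\<dots> \<le> \<epsilon>"
      using n(1) n1 \<epsilon> by (simp add: field_simps)
    finally show "ereal \<bar>g d x - realization relu \<phi> x $ 0\<bar> \<le> ereal \<epsilon>"
      by (simp add: real[OF xc] assms(7)[OF d xc])
  qed
  have "real (num_params \<phi>) = 2 * real n * (real d + 2) + 1"
    by (simp add: \<phi>_def num_params_ridge_skeleton algebra_simps)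
  also have "\<dots> \<le> 2 * (4 * (K * R / \<epsilon>) + 1) * (real d + 2) + 1"
    using n(2) by (intro add_right_mono mult_right_mono mult_left_mono) auto
  also have "\<dots> \<le> 1 / 7 * 10 ^ 3 * K\<^sup>2 * r * S\<^sup>2 * real d ^ 6 * inverse \<epsilon>"
    using params_bound[OF assms(1,2,3) d \<epsilon>] by (simp add: R_def)
  finally have params:
    "real (num_params \<phi>) \<le> 1 / 7 * 10 ^ 3 * K\<^sup>2 * r * S\<^sup>2 * real d ^ 6 * inverse \<epsilon>" .
  have "\<phi> \<in> skeletons" "layer_size \<phi> 0 = d" "layer_size \<phi> (length \<phi>) = 1"
    using d n1 by (simp_all only: \<phi>_def length_ridge_skeleton layer_size_ridge_skeleton)
      (simp add: ridge_skeleton_in_skeletons)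
  then show "\<exists>\<phi>\<in>skeletons.
       layer_size \<phi> 0 = d \<and> layer_size \<phi> (length \<phi>) = 1 \<and>
       realization relu \<phi> \<in> continuous_maps d 1 \<and>
       (SUP x\<in>cube d r. ereal \<bar>g d x - realization relu \<phi> x $ 0\<bar>) \<le> ereal \<epsilon> \<and>
       lipschitz_map (sqrt (real d) * K * S) d (realization relu \<phi>) \<and>
       real (num_params \<phi>) \<le> 1 / 7 * 10 ^ 3 * K\<^sup>2 * r * S\<^sup>2 * real d ^ 6 * inverse \<epsilon>"
    using cont sup lipm params by blast
qed

end
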